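(* Let $N\ge2$, let $Y_{\mathcal A}$ be the admittance matrix of a connected electrical network with boundary nodes $\{1,\dots,N\}$, let $Y\in\mathbb C^{N\times N}$ be its Kron-reduced admittance matrix, and let $\Gamma=NI-\mathbf 1\mathbf 1^{\mathrm T}$. Consider the following two cases. 1) No shunt elements. Assume that $Y_{\mathcal A}$ is singular due to the absence of shunt elements. Let $Z=(z_{nm})\in\mathbb C^{N\times N}$ be the matrix of effective impedances among the boundary nodes. The following statements are equivalent: (i) The effective impedances among the boundary nodes $\{1,\dots,N\}$ are uniform, that is, there is $z_{\mathrm{eff}}\in\mathbb C\setminus\{0\}$ such that $z_{nm}=z_{\mathrm{eff}}$ for all distinct $n,m\in\{1,\dots,N\}$. (ii) The branch admittances in the Kron-reduced network take the uniform value $y_{\mathrm{series}}\in\mathbb C\setminus\{0\}$, that is, $Y=y_{\mathrm{series}}\Gamma$. If (i) and (ii) are true, then $z_{\mathrm{eff}}=\dfrac{2}{N y_{\mathrm{series}}}$. 2) Shunt elements. Assume that $Y_{\mathcal A}$ is nonsingular due to the presence of shunt elements. Consider the grounded node $|\mathcal A|+1$ and the augmented admittance matrices $\widehat Y_{\mathcal A}$ and $\widehat Y$. Let $Z=(z_{nm})\in\mathbb C^{(|\mathcal A|+1)\times(|\mathcal A|+1)}$ be the matrix of effective impedances in the augmented network. The following statements are equivalent: (iii) The effective impedances both among the boundary nodes $\{1,\dots,N\}$ and between all boundary nodes $\{1,\dots,N\}$ and the grounded node $|\mathcal A|+1$ are uniform, that is, there are $z_{\mathrm{eff-series}},z_{\mathrm{eff-shunt}}\in\mathbb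 C\setminus\{0\}$ satisfying $\dfrac{z_{\mathrm{eff-series}}}{z_{\mathrm{eff-shunt}}}\ne\dfrac{2N}{N-1}$ such that $z_{nm}=z_{\mathrm{eff-series}}$ for all distinct $n,m\in\{1,\dots,N\}$ and $z_{n,|\mathcal A|+1}=z_{\mathrm{eff-shunt}}$ for all $n\in\{1,\dots,N\}$. (iv) The branch and shunt admittances in the Kron-reduced network are uniform, that is, there are $y_{\mathrm{series}},y_{\mathrm{shunt}}\in\mathbb C\setminus\{0\}$ satisfying $y_{\mathrm{shunt}}\neq -N y_{\mathrm{series}}$ such that $Y=y_{\mathrm{shunt}}I+y_{\mathrm{series}}\Gamma$. If (iii) and (iv) are true, then $$z_{\mathrm{eff-series}}=\frac{2}{N y_{\mathrm{series}}+y_{\mathrm{shunt}}},\qquad z_{\mathrm{eff-shunt}}=\frac{y_{\mathrm{shunt}}+y_{\mathrm{series}}}{y_{\mathrm{shunt}}\,(N y_{\mathrm{series}}+y_{\mathrm{shunt}})}.$$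
   Context: Network. A connected undirected graph has node set $\mathcal A=\{1,\dots,|\mathcal A|\}$ and edge (branch) set $\mathcal E$; $\mathcal N=\{1,\dots,N\}\subseteq\mathcal A$ are the boundary nodes and $\mathcal I=\mathcal A\setminus\mathcal N$ the interior nodes. Each branch $(m,n)\in\mathcal E$ has a nonzero admittance $y_{mn}=y_{nm}\in\mathbb C$ and each node $m$ has a shunt admittance $y_m\in\mathbb C$ to ground, with $y_m=0$ for $m\in\mathcal N$. The admittance matrix $Y_{\mathcal A}$ has entries $[Y_{\mathcal A}]_{mm}=y_m+\sum_{(m,k)\in\mathcal E}y_{mk}$, $[Y_{\mathcal A}]_{mn}=-y_{mn}$ if $(m,n)\in\mathcal E$, and $0$ otherwise. Write $$Y_{\mathcal A}=\begin{bmatrix}Y_{\mathcal{NN}}&Y_{\mathcal{NI}}\\ Y_{\mathcal{NI}}^{\mathrm T}&Y_{\mathcal{II}}\end{bmatrix},\qquad Y:=Y_{\mathcal{NN}}-Y_{\mathcal{NI}}Y_{\mathcal{II}}^{-1}Y_{\mathcal{NI}}^{\mathrm T},$$ where $Y$ is the Kron-reduced admittance matrix; the Kron-reduced network on $\{1,\dots,N\}$ has branch admittances $-Y_{nm}$ and shunt admittances equal to the row sums of $Y$. The augmented admittance matrix models the ground as an additional node $|\mathcal A|+1$: $$\widehat Y_{\mathcal A}=\begin{bmatrix}Y_{\mathcal A}&-y\\-y^{\mathrm T}&\sum_{m=1}^{|\mathcal A|}y_m\end{bmatrix},\qquad y=[y_1,\dots,y_{|\mathcal A|}]^{\mathrm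 T},$$ and $\widehat Y$ is the Kron-reduced matrix of $\widehat Y_{\mathcal A}$, obtained by eliminating the interior nodes $\mathcal I$ through the Schur complement. Effective impedances: $z_{nm}=(e_n-e_m)^{\mathrm T}Y_{\mathcal A}^\dagger(e_n-e_m)$ in case 1) and $z_{nm}=(e_n-e_m)^{\mathrm T}\widehat Y_{\mathcal A}^\dagger(e_n-e_m)$ in case 2), where $\dagger$ is the Moore-Penrose pseudoinverse, $e_n$ the canonical basis vectors, and $(\cdot)^{\mathrm T}$ transposition without conjugation. $I$ is the identity matrix and $\mathbf 1$ the all-ones vector. Standing assumption: all principal submatrices of $Y_{\mathcal A}$ are nonsingular (apart from $Y_{\mathcal A}$ itself in case 1), where it is singular).
   Formalization: In case 2, statement (iii) is additionally required to satisfy z_eff-series/z_eff-shunt ≠ 2 in the equivalence with (iv); at ratio 2 the Kron-reduced matrix Y is diagonal (y_series = 0), so (iii) can hold while (iv) fails. *)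

theory Defs
  imports
    "Jordan_Normal_Form.DL_Submatrix"
    "Jordan_Normal_Form.Gauss_Jordan_Elimination"
    "Jordan_Normal_Form.Schur_Decomposition"
begin

text \<open>
  Matrices and vectors are indexed from 0, and so are the nodes: the \<open>a\<close> nodes of a network are
  \<open>{..<a}\<close>, its boundary nodes are \<open>{..<N}\<close>, its interior nodes are \<open>{N..<a}\<close>, and the ground,
  where it is modelled as an additional node, is \<open>a\<close>.
\<close>

text \<open>
  The set \<open>E\<close> of branches contains both orientations of every branch. Values of \<open>y\<close> outside \<open>E\<close> and
  of \<open>y\<^sub>s\<close> outside \<open>{..<a}\<close> are irrelevant.
\<close>

locale electrical_network =
  fixes a N :: nat
    and E :: "(nat \<times> nat) set"
    and y :: "nat \<Rightarrow> nat \<Rightarrow> complex"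
    and y\<^sub>s :: "nat \<Rightarrow> complex"
  assumes boundary_le: "N \<le> a"
    and branches: "E \<subseteq> {..<a} \<times> {..<a}" "sym E" "irrefl E"
    and connected: "\<And>m n. m < a \<Longrightarrow> n < a \<Longrightarrow> (m, n) \<in> E\<^sup>*"
    and branch_nonzero: "\<And>m n. (m, n) \<in> E \<Longrightarrow> y m n \<noteq> 0"
    and branch_sym: "\<And>m n. (m, n) \<in> E \<Longrightarrow> y m n = y n m"
    and boundary_shunt: "\<And>m. m < N \<Longrightarrow> y\<^sub>s m = 0"

definition admittance_matrix ::
  "nat \<Rightarrow> (nat \<times> nat) set \<Rightarrow> (nat \<Rightarrow> nat \<Rightarrow> complex) \<Rightarrow> (nat \<Rightarrow> complex) \<Rightarrow> complex mat" where
  "admittance_matrix a E y y\<^sub>s = mat a a (\<lambda>(m, n).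
     if m = n then y\<^sub>s m + (\<Sum>k | (m, k) \<in> E. y m k)
     else if (m, n) \<in> E then - y m n
     else 0)"

definition augmented_admittance_matrix ::
  "nat \<Rightarrow> (nat \<times> nat) set \<Rightarrow> (nat \<Rightarrow> nat \<Rightarrow> complex) \<Rightarrow> (nat \<Rightarrow> complex) \<Rightarrow> complex mat" where
  "augmented_admittance_matrix a E y y\<^sub>s =
     four_block_mat (admittance_matrix a E y y\<^sub>s) (mat a 1 (\<lambda>(m, _). - y\<^sub>s m))
                    (mat 1 a (\<lambda>(_, n). - y\<^sub>s n)) (mat 1 1 (\<lambda>_. \<Sum>m<a. y\<^sub>s m))"

text \<open>Only used when the interior block is nonsingular, so that \<^const>\<open>the\<close> is applied to its inverse.\<close>

definition kron_reduction :: "nat \<Rightarrow> complex mat \<Rightarrow> complex mat" where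
  "kron_reduction N M =
     (let B = {..<N}; I = {N..<dim_row M} in
        submatrix M B B
        - submatrix M B I * the (mat_inverse (submatrix M I I)) * transpose_mat (submatrix M B I))"

definition proper_principal_submatrices_nonsingular :: "complex mat \<Rightarrow> bool" where
  "proper_principal_submatrices_nonsingular M \<longleftrightarrow>
     (\<forall>S. S \<noteq> {} \<and> S \<subset> {..<dim_row M} \<longrightarrow> invertible_mat (submatrix M S S))"

definition is_pseudoinverse :: "complex mat \<Rightarrow> complex mat \<Rightarrow> bool" where
  "is_pseudoinverse A X \<longleftrightarrow>
     X \<in> carrier_mat (dim_col A) (dim_row A) \<and>
     A * X * A = A \<and>
     X * A * X = X \<and>
     mat_adjoint (A * X) = A * X \<and>
     mat_adjoint (X * A) = X * A"

definition pseudoinverse :: "complex mat \<Rightarrow> complex mat" where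
  "pseudoinverse A = (THE X. is_pseudoinverse A X)"

text \<open>The scalar product \<open>\<bullet>\<close> is bilinear: no argument is conjugated.\<close>

definition effective_impedance :: "complex mat \<Rightarrow> nat \<Rightarrow> nat \<Rightarrow> complex" where
  "effective_impedance M n m =
     (let u = unit_vec (dim_row M) n - unit_vec (dim_row M) m in u \<bullet> (pseudoinverse M *\<^sub>v u))"

definition Gamma_mat :: "nat \<Rightarrow> complex mat" where
  "Gamma_mat N = of_nat N \<cdot>\<^sub>m 1\<^sub>m N - mat N N (\<lambda>_. 1)"

definition uniform_impedances :: "nat \<Rightarrow> (nat \<Rightarrow> nat \<Rightarrow> complex) \<Rightarrow> complex \<Rightarrow> bool" where
  "uniform_impedances N z z_eff \<longleftrightarrow>
     z_eff \<noteq> 0 \<and> (\<forall>n<N. \<forall>m<N. n \<noteq> m \<longrightarrow> z n m = z_eff)"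

definition uniform_admittances :: "nat \<Rightarrow> complex mat \<Rightarrow> complex \<Rightarrow> bool" where
  "uniform_admittances N Y y_series \<longleftrightarrow> y_series \<noteq> 0 \<and> Y = y_series \<cdot>\<^sub>m Gamma_mat N"

text \<open>
  The excluded ratio \<open>2N / (N - 1)\<close> corresponds to \<open>y_shunt = - N y_series\<close>. The ratio 2, which corresponds
  to \<open>y_series = 0\<close> (a diagonal reduced matrix), is not excluded here.
\<close>

definition uniform_impedances_shunt ::
  "nat \<Rightarrow> nat \<Rightarrow> (nat \<Rightarrow> nat \<Rightarrow> complex) \<Rightarrow> complex \<Rightarrow> complex \<Rightarrow> bool" where
  "uniform_impedances_shunt N ground z z_series z_shunt \<longleftrightarrow>
     z_series \<noteq> 0 \<and> z_shunt \<noteq> 0 \<and> z_series / z_shunt \<noteq> 2 * of_nat N / (of_nat N - 1) \<and>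
     (\<forall>n<N. \<forall>m<N. n \<noteq> m \<longrightarrow> z n m = z_series) \<and>
     (\<forall>n<N. z n ground = z_shunt)"

definition uniform_admittances_shunt ::
  "nat \<Rightarrow> complex mat \<Rightarrow> complex \<Rightarrow> complex \<Rightarrow> bool" where
  "uniform_admittances_shunt N Y y_series y_shunt \<longleftrightarrow>
     y_series \<noteq> 0 \<and> y_shunt \<noteq> 0 \<and> y_shunt \<noteq> - of_nat N * y_series \<and>
     Y = y_shunt \<cdot>\<^sub>m 1\<^sub>m N + y_series \<cdot>\<^sub>m Gamma_mat N"

end

theory Submission
  imports Defs
begin

text \<open>
  In both cases the relevant matrix (\<open>Y\<^sub>A\<close> without shunts, the augmented matrix with shunts) is
  symmetric and its kernel is spanned by the all-ones vector. Hence an effective impedance is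
  \<open>x n - x m\<close> for any potential \<open>x\<close> with current \<open>e n - e m\<close>, and conversely the potential \<open>x\<close>
  belonging to the current \<open>e k - e g\<close> is recovered by polarisation:
  \<open>x l - x g = (z k g + z l g - z k l) / 2\<close>. Kron reduction relates boundary potentials to boundary
  currents when the interior currents vanish. Uniform impedances therefore say that the boundary
  potentials of unit currents are of the form \<open>\<alpha> e k + \<beta> 1\<close> (with shunts, relative to the ground) or
  \<open>z / 2 (e k - e m) + c 1\<close> (without shunts), which is the inverse of the uniform form of the reduced
  matrix.

  With shunts, uniform admittances with \<open>y_shunt = - y_series\<close> would give a vanishing impedance to
  ground. This is excluded by the principal submatrix that omits a single boundary node.
\<close>

section \<open>Adjoints and uniqueness of the pseudoinverse\<close>

lemma index_mat_adjoint:
  "i < dim_col A \<Longrightarrow> j < dim_row A \<Longrightarrow> mat_adjoint A $$ (i, j) = conjugate (A $$ (j, i))"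
  unfolding mat_adjoint_def by (simp add: mat_of_rows_def)

lemma dim_mat_adjoint [simp]:
  "dim_row (mat_adjoint A) = dim_col A" "dim_col (mat_adjoint A) = dim_row A"
  unfolding mat_adjoint_def by auto

lemma mat_adjoint_mult:
  fixes A B :: "complex mat"
  assumes "A \<in> carrier_mat r n" "B \<in> carrier_mat n c"
  shows "mat_adjoint (A * B) = mat_adjoint B * mat_adjoint A"
proof (rule eq_matI)
  fix i j assume "i < dim_row (mat_adjoint B * mat_adjoint A)" "j < dim_col (mat_adjoint B * mat_adjoint A)"
  then show "mat_adjoint (A * B) $$ (i, j) = (mat_adjoint B * mat_adjoint A) $$ (i, j)"
    using assms by (auto simp: index_mat_adjoint scalar_prod_def mult.commute intro!: sum.cong)
qed (use assms in auto)

text \<open>Penrose's argument: \<open>A * X * (A * Z)\<close> collapses to \<open>A * Z\<close> and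
  its adjoint to \<open>A * X\<close>, and both factors are self-adjoint, so
  \<open>A * X = A * Z\<close>. Symmetrically \<open>X * A = Z * A\<close>, whence
  \<open>X = Z * A * X = Z * A * Z = Z\<close>.\<close>

lemma is_pseudoinverse_unique:
  assumes X: "is_pseudoinverse A X" and Z: "is_pseudoinverse A Z"
  shows "X = Z"
proof -
  define r c where rc: "r = dim_row A" "c = dim_col A"
  have carr: "A \<in> carrier_mat r c" "X \<in> carrier_mat c r" "Z \<in> carrier_mat c r"
    using X Z by (auto simp: rc is_pseudoinverse_def)
  note AX = mult_carrier_mat[OF carr(1,2)] and AZ = mult_carrier_mat[OF carr(1,3)]
    and XA = mult_carrier_mat[OF carr(2,1)] and ZA = mult_carrier_mat[OF carr(3,1)]
  have p: "A * X * A = A" "X * A * X = X" "mat_adjoint (A * X) = A * X" "mat_adjoint (X * A) = X * A"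
    and q: "A * Z * A = A" "Z * A * Z = Z" "mat_adjoint (A * Z) = A * Z" "mat_adjoint (Z * A) = Z * A"
    using X Z by (simp_all add: is_pseudoinverse_def)
  have "A * Z * (A * X) = mat_adjoint (A * X * (A * Z))"
    using p q by (simp add: mat_adjoint_mult[OF AX AZ])
  also have "A * X * (A * Z) = A * X * A * Z" by (rule assoc_mult_mat[symmetric, OF AX carr(1,3)])
  also have "A * Z * (A * X) = A * Z * A * X" by (rule assoc_mult_mat[symmetric, OF AZ carr(1,2)])
  finally have AX_eq: "A * X = A * Z" using p q by simp
  have "Z * A * (X * A) = mat_adjoint (X * A * (Z * A))"
    using p q by (simp add: mat_adjoint_mult[OF XA ZA])
  also have "X * A * (Z * A) = X * A * Z * A" by (rule assoc_mult_mat[symmetric, OF XA carr(3,1)])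
  also have "X * A * Z = X * (A * Z)" by (rule assoc_mult_mat[OF carr(2,1,3)])
  also have "X * (A * Z) * A = X * (A * Z * A)" by (rule assoc_mult_mat[OF carr(2) AZ carr(1)])
  also have "Z * A * (X * A) = Z * A * X * A" by (rule assoc_mult_mat[symmetric, OF ZA carr(2,1)])
  also have "Z * A * X = Z * (A * X)" by (rule assoc_mult_mat[OF carr(3,1,2)])
  also have "Z * (A * X) * A = Z * (A * X * A)" by (rule assoc_mult_mat[OF carr(3) AX carr(1)])
  finally have XA_eq: "X * A = Z * A" using p q by simp
  have "X = Z * A * X" using p XA_eq by simp
  also have "\<dots> = Z * (A * Z)" by (simp add: assoc_mult_mat[OF carr(3,1,2)] AX_eq)
  also have "\<dots> = Z" using q by (simp add: assoc_mult_mat[OF carr(3,1,3)])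
  finally show ?thesis .
qed

lemma pseudoinverse_eq: "is_pseudoinverse A X \<Longrightarrow> pseudoinverse A = X"
  unfolding pseudoinverse_def by (blast intro: the_equality is_pseudoinverse_unique)

section \<open>Potentials and impedances for symmetric matrices with constant kernel\<close>

abbreviation ones_vec :: "nat \<Rightarrow> complex vec" where
  "ones_vec n \<equiv> vec n (\<lambda>_. 1)"

locale balanced_matrix =
  fixes M :: "complex mat" and n :: nat
  assumes carrier: "M \<in> carrier_mat n n"
    and pos: "0 < n"
    and sym: "transpose_mat M = M"
    and ones: "M *\<^sub>v ones_vec n = 0\<^sub>v n"
    and kernel: "\<And>v. v \<in> carrier_vec n \<Longrightarrow> M *\<^sub>v v = 0\<^sub>v n \<Longrightarrow> \<exists>c. v = c \<cdot>\<^sub>v ones_vec n"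
begin

text \<open>Only transposition enters, no conjugation: \<open>M\<close> is complex symmetric and in
  general not Hermitian.\<close>

lemma reciprocity:
  assumes "v \<in> carrier_vec n" "w \<in> carrier_vec n"
  shows "v \<bullet> (M *\<^sub>v w) = w \<bullet> (M *\<^sub>v v)"
proof -
  have "v \<bullet> (M *\<^sub>v w) = (transpose_mat M *\<^sub>v v) \<bullet> w"
    using assms carrier by (simp add: transpose_vec_mult_scalar)
  then show ?thesis
    using assms carrier sym by (simp add: comm_scalar_prod[of _ n])
qed

text \<open>The orthogonal projection onto the kernel of \<open>M\<close>.\<close>

definition averaging :: "complex mat" where
  "averaging = mat n n (\<lambda>_. 1 / of_nat n)"

lemma averaging_carrier [simp]: "averaging \<in> carrier_mat n n"
  by (simp add: averaging_def)

lemma averaging_mult_vec: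
  assumes "v \<in> carrier_vec n"
  shows "averaging *\<^sub>v v = ((ones_vec n \<bullet> v) / of_nat n) \<cdot>\<^sub>v ones_vec n"
  using assms by (intro eq_vecI) (auto simp: averaging_def scalar_prod_def sum_divide_distrib)

lemma averaging_idem: "averaging * averaging = averaging"
  using pos by (intro eq_matI) (auto simp: averaging_def scalar_prod_def)

lemma mult_averaging: "M * averaging = 0\<^sub>m n n"
proof (rule eq_matI)
  fix i j assume "i < dim_row (0\<^sub>m n n :: complex mat)" "j < dim_col (0\<^sub>m n n :: complex mat)"
  then have ij: "i < n" "j < n" by auto
  have "(M *\<^sub>v ones_vec n) $ i = 0" using ij by (simp add: ones)
  then show "(M * averaging) $$ (i, j) = 0\<^sub>m n n $$ (i, j)"
    using ij carrier by (simp add: averaging_def scalar_prod_def sum_divide_distrib[symmetric])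
qed (use carrier in \<open>auto simp: averaging_def\<close>)

lemma averaging_mult: "averaging * M = 0\<^sub>m n n"
proof -
  have "transpose_mat (averaging * M) = transpose_mat M * transpose_mat averaging"
    using carrier by (intro transpose_mult[of _ n n]) auto
  also have "transpose_mat averaging = averaging"
    by (auto simp: averaging_def)
  finally have "transpose_mat (averaging * M) = 0\<^sub>m n n"
    by (simp add: sym mult_averaging)
  then show ?thesis
    by (metis transpose_transpose zero_transpose_mat)
qed

text \<open>The pseudoinverse is \<open>(M + J / n)\<^sup>-\<^sup>1 - J / n\<close>, where \<open>J\<close> is the all-ones matrix.\<close>

lemma is_pseudoinverse_exists:
  "\<exists>X. is_pseudoinverse M X \<and> M * X = 1\<^sub>m n - averaging"
proof -
  let ?K = averaging and ?I = "1\<^sub>m n :: complex mat"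
  have MK: "M + ?K \<in> carrier_mat n n" by simp
  have "det (M + ?K) \<noteq> 0"
  proof
    assume "det (M + ?K) = 0"
    then obtain v where v: "v \<in> carrier_vec n" "v \<noteq> 0\<^sub>v n" "(M + ?K) *\<^sub>v v = 0\<^sub>v n"
      using det_0_iff_vec_prod_zero_field[OF MK] by auto
    \<comment> \<open>Since \<open>?K\<close> annihilates \<open>M\<close>, a kernel vector of
      \<open>M + ?K\<close> has mean zero. It then lies in the kernel of \<open>M\<close>, so it is
      constant, and a constant with mean zero vanishes.\<close>
    have "?K * (M + ?K) = ?K"
      using carrier by (simp add: mult_add_distrib_mat[of ?K n n M n ?K] averaging_mult averaging_idem)
    then have "?K *\<^sub>v v = ?K *\<^sub>v ((M + ?K) *\<^sub>v v)"
      using v(1) assoc_mult_mat_vec[OF averaging_carrier MK v(1)] by simp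
    also have "\<dots> = 0\<^sub>v n"
      using v by (auto simp: averaging_def scalar_prod_def intro!: eq_vecI)
    finally have Kv: "?K *\<^sub>v v = 0\<^sub>v n" .
    then have "M *\<^sub>v v = 0\<^sub>v n"
      using v carrier by (simp add: add_mult_distrib_mat_vec[of _ n n])
    then obtain c where c: "v = c \<cdot>\<^sub>v ones_vec n" using kernel v by blast
    have "(?K *\<^sub>v v) $ 0 = c"
      using pos by (simp add: c averaging_def scalar_prod_def)
    then show False using Kv c v pos by auto
  qed
  then obtain G where G: "G \<in> carrier_mat n n" "G * (M + ?K) = ?I" "(M + ?K) * G = ?I"
    using det_non_zero_imp_unit[OF MK] unfolding Units_def ring_mat_def by auto
  \<comment> \<open>The inverse \<open>G\<close> inherits the action of \<open>M + ?K\<close> on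
    constants: expanding the product on either side of \<open>?K\<close> gives
    \<open>?K * G = ?K\<close> and \<open>G * ?K = ?K\<close>.\<close>
  have "?K * ((M + ?K) * G) = ?K"
    by (simp only: G right_mult_one_mat[OF averaging_carrier])
  moreover have "?K * ((M + ?K) * G) = (?K * M + ?K * ?K) * G"
    using G(1) carrier by (simp add: assoc_mult_mat[symmetric, of _ n n _ n _ n] mult_add_distrib_mat[of _ n n])
  ultimately have KG: "?K * G = ?K" using G by (simp add: averaging_mult averaging_idem)
  have "G * (M + ?K) * ?K = ?K"
    by (simp only: G left_mult_one_mat[OF averaging_carrier])
  moreover have "G * (M + ?K) * ?K = G * (M * ?K + ?K * ?K)"
    using G(1) carrier
    by (subst assoc_mult_mat[OF G(1) MK averaging_carrier])
      (simp only: add_mult_distrib_mat[OF carrier averaging_carrier averaging_carrier])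
  ultimately have GK: "G * ?K = ?K" using G by (simp add: mult_averaging averaging_idem)
  define X where "X = G - ?K"
  have X: "X \<in> carrier_mat n n" unfolding X_def by (rule minus_carrier_mat) simp
  have MG: "M * G + ?K = ?I" and GM: "G * M + ?K = ?I"
    using G carrier KG GK by (simp_all add: add_mult_distrib_mat[of _ n n] mult_add_distrib_mat[of _ n n])
  have add_diff: "B = C - D" if "B + D = C" "B \<in> carrier_mat n n" "D \<in> carrier_mat n n" for B C D :: "complex mat"
    using that by (auto intro!: eq_matI)
  have minus_zero: "F - 0\<^sub>m n n = F" if "F \<in> carrier_mat n n" for F :: "complex mat"
    using that by (intro eq_matI) auto
  have IK: "?I - ?K \<in> carrier_mat n n" by (rule minus_carrier_mat) simp
  have MX: "M * X = ?I - ?K"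
    using G carrier add_diff[OF MG] minus_zero[OF IK]
    by (simp add: X_def mult_minus_distrib_mat[of _ n n] mult_averaging)
  have XM: "X * M = ?I - ?K"
    using G carrier add_diff[OF GM] minus_zero[OF IK]
    by (simp add: X_def minus_mult_distrib_mat[of _ n n] averaging_mult)
  have KX: "?K * X = 0\<^sub>m n n"
    using G by (simp add: X_def mult_minus_distrib_mat[of _ n n] KG averaging_idem)
  \<comment> \<open>Both \<open>M * X\<close> and \<open>X * M\<close> equal this projection, which
    is real and symmetric; hence the Penrose conditions on adjoints hold although \<open>M\<close>
    need not be Hermitian.\<close>
  have "mat_adjoint (?I - ?K) = ?I - ?K"
    by (rule eq_matI) (auto simp: index_mat_adjoint averaging_def)
  moreover have "(?I - ?K) * M = M"
    using carrier minus_zero by (simp add: minus_mult_distrib_mat[of _ n n] averaging_mult)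
  moreover have "(?I - ?K) * X = X"
    using X minus_zero by (simp add: minus_mult_distrib_mat[of _ n n] KX)
  ultimately have "is_pseudoinverse M X"
    using carrier X unfolding is_pseudoinverse_def MX XM by auto
  then show ?thesis using MX by blast
qed

text \<open>\<open>M\<close> times its pseudoinverse is the projection
  \<open>1\<^sub>m n - averaging\<close>, which fixes every current of total zero.\<close>

lemma solvable:
  assumes u: "u \<in> carrier_vec n" and "ones_vec n \<bullet> u = 0"
  shows "pseudoinverse M *\<^sub>v u \<in> carrier_vec n" "M *\<^sub>v (pseudoinverse M *\<^sub>v u) = u"
proof -
  obtain X where X: "is_pseudoinverse M X" and MX: "M * X = 1\<^sub>m n - averaging"
    using is_pseudoinverse_exists by blast
  have eq: "pseudoinverse M = X" using X by (rule pseudoinverse_eq)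
  have Xc: "X \<in> carrier_mat n n" using X carrier by (auto simp: is_pseudoinverse_def)
  show "pseudoinverse M *\<^sub>v u \<in> carrier_vec n" using Xc u by (simp add: eq)
  have "M *\<^sub>v (X *\<^sub>v u) = (M * X) *\<^sub>v u"
    using Xc carrier u by simp
  also have "\<dots> = u"
    using u assms(2) by (simp add: MX minus_mult_distrib_mat_vec[of _ n n] averaging_mult_vec) auto
  finally show "M *\<^sub>v (pseudoinverse M *\<^sub>v u) = u" by (simp add: eq)
qed

lemma unit_diff_solvable:
  assumes "k < n" "l < n"
  shows "\<exists>x\<in>carrier_vec n. M *\<^sub>v x = unit_vec n k - unit_vec n l"
  using assms by (intro bexI solvable) (auto simp: scalar_prod_minus_distrib[of _ n] intro!: solvable)

lemma scalar_prod_unit_diff: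
  fixes x :: "complex vec"
  assumes "x \<in> carrier_vec n" "k < n" "l < n"
  shows "(unit_vec n k - unit_vec n l) \<bullet> x = x $ k - x $ l"
  using assms by (simp add: minus_scalar_prod_distrib[of _ n])

text \<open>Frees later arguments from the pseudoinverse. With \<open>x'\<close> the potential that
  it selects, reciprocity gives \<open>u \<bullet> x' = (M x) \<bullet> x' = x \<bullet> (M x') = x
  \<bullet> u\<close>.\<close>

lemma effective_impedance_eq:
  assumes x: "x \<in> carrier_vec n" "M *\<^sub>v x = unit_vec n k - unit_vec n l" and "k < n" "l < n"
  shows "effective_impedance M k l = x $ k - x $ l"
proof -
  define u :: "complex vec" where "u = unit_vec n k - unit_vec n l"
  have u: "u \<in> carrier_vec n" and u0: "ones_vec n \<bullet> u = 0"
    using assms by (auto simp: u_def scalar_prod_minus_distrib[of _ n])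
  define x' where "x' = pseudoinverse M *\<^sub>v u"
  have x': "x' \<in> carrier_vec n" "M *\<^sub>v x' = u"
    using solvable[OF u u0] by (auto simp: x'_def)
  have "effective_impedance M k l = u \<bullet> x'"
    using carrier by (simp add: effective_impedance_def Let_def u_def x'_def)
  also have "\<dots> = x' \<bullet> (M *\<^sub>v x)"
    using u x'(1) x(2) by (simp add: comm_scalar_prod[of u n] flip: u_def)
  also have "\<dots> = x \<bullet> u" using reciprocity[OF x'(1) x(1)] x'(2) by simp
  also have "\<dots> = x $ k - x $ l"
    using x u assms by (simp add: comm_scalar_prod[of x n] u_def scalar_prod_unit_diff)
  finally show ?thesis .
qed

text \<open>By reciprocity, the impedances are the values of the quadratic form whose bilinear form is the
  grounded potential; this is its polarisation.\<close>

lemma potential_polarisation: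
  assumes x: "x \<in> carrier_vec n" "M *\<^sub>v x = unit_vec n k - unit_vec n g" and lt: "k < n" "g < n" "l < n"
  shows "x $ l - x $ g
    = (effective_impedance M k g + effective_impedance M l g - effective_impedance M k l) / 2"
proof -
  \<comment> \<open>Superposition: \<open>x - w\<close> carries the current from \<open>k\<close> to
    \<open>l\<close>, and reciprocity trades \<open>w $ k - w $ g\<close> for
    \<open>x $ l - x $ g\<close>.\<close>
  obtain w where w: "w \<in> carrier_vec n" "M *\<^sub>v w = unit_vec n l - unit_vec n g"
    using unit_diff_solvable lt by blast
  have "w \<bullet> (M *\<^sub>v x) = w $ k - w $ g" "x \<bullet> (M *\<^sub>v w) = x $ l - x $ g"
    using x w lt by (simp_all add: comm_scalar_prod[of x n] comm_scalar_prod[of w n] scalar_prod_unit_diff)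
  then have recip: "w $ k - w $ g = x $ l - x $ g"
    using reciprocity x w by metis
  have "M *\<^sub>v (x - w) = unit_vec n k - unit_vec n l"
    using x w carrier by (simp add: mult_minus_distrib_mat_vec[of _ n n]) (auto intro!: eq_vecI)
  then have "effective_impedance M k l = (x $ k - w $ k) - (x $ l - w $ l)"
    using effective_impedance_eq[of "x - w" k l] x w lt by simp
  moreover have "w $ k = x $ l - x $ g + w $ g" using recip by (simp add: algebra_simps)
  ultimately show ?thesis
    using effective_impedance_eq[OF x] effective_impedance_eq[OF w] lt by simp
qed

end

section \<open>Inverses and principal submatrices\<close>

lemma invertible_matE:
  assumes "A \<in> carrier_mat n n" "invertible_mat A"
  obtains B where "B \<in> carrier_mat n n" "A * B = 1\<^sub>m n" "B * A = 1\<^sub>m n"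
proof -
  from assms obtain B where B: "A * B = 1\<^sub>m n" "B * A = 1\<^sub>m (dim_row B)"
    by (auto simp: invertible_mat_def inverts_mat_def)
  from arg_cong[OF B(1), of dim_col] arg_cong[OF B(2), of dim_col] have "B \<in> carrier_mat n n"
    using assms by auto
  then show ?thesis using B that by auto
qed

text \<open>Justifies \<open>the\<close> in \<open>kron_reduction\<close>: an invertible matrix is a
  unit of the matrix ring, and \<open>mat_inverse\<close> returns \<open>None\<close> only on
  non-units.\<close>

lemma the_mat_inverse:
  assumes A: "A \<in> carrier_mat n n" and "invertible_mat A"
  shows "the (mat_inverse A) \<in> carrier_mat n n"
    "A * the (mat_inverse A) = 1\<^sub>m n" "the (mat_inverse A) * A = 1\<^sub>m n"
proof -
  have "A \<in> Units (ring_mat TYPE('a) n ())"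
    using A invertible_matE[OF assms] by (auto simp: Units_def ring_mat_def)
  then obtain B where "mat_inverse A = Some B"
    using mat_inverse(1)[OF A, of "()"] by (cases "mat_inverse A") auto
  with mat_inverse(2)[OF A this]
  show "the (mat_inverse A) \<in> carrier_mat n n"
    "A * the (mat_inverse A) = 1\<^sub>m n" "the (mat_inverse A) * A = 1\<^sub>m n" by auto
qed

text \<open>\<open>m + i\<close> is the member of the interval with exactly \<open>i\<close> members
  below it.\<close>

lemma pick_atLeastLessThan:
  assumes "i < n - m"
  shows "pick {m..<n} i = m + i"
proof -
  have "{k \<in> {m..<n}. k < m + i} = {m..<m + i}" using assms by auto
  then show ?thesis
    using pick_card_in_set[of "m + i" "{m..<n}"] assms by simp
qed

text \<open>Turns sums over submatrix indices into sums over \<open>S\<close>. \<open>pick S\<close>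
  is strictly increasing, and the preimage of an element is its rank in \<open>S\<close>.\<close>

lemma bij_betw_pick:
  assumes "finite S"
  shows "bij_betw (pick S) {..<card S} S"
proof (rule bij_betwI')
  show "pick S i = pick S j \<longleftrightarrow> i = j" if "i \<in> {..<card S}" "j \<in> {..<card S}" for i j
    using that pick_mono_le[of i S j] pick_mono_le[of j S i] by (cases i j rule: linorder_cases) auto
  show "pick S i \<in> S" if "i \<in> {..<card S}" for i
    using that pick_in_set_le by auto
  show "\<exists>i\<in>{..<card S}. k = pick S i" if "k \<in> S" for k
    using that assms pick_card_in_set[of k S] by (intro bexI[of _ "card {j\<in>S. j < k}"]) (auto intro!: psubset_card_mono)
qed

text \<open>For \<open>x\<close> supported on \<open>S\<close>, the rows of
  \<open>A *\<^sub>v x\<close> in \<open>S\<close> are the submatrix applied to the restriction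
  \<open>x'\<close> of \<open>x\<close>. It is applied below with \<open>S\<close> omitting a single
  node.\<close>

lemma principal_submatrix_kernel:
  fixes A :: "'a :: field mat"
  assumes A: "A \<in> carrier_mat n n" and S: "S \<subseteq> {..<n}" and inv: "invertible_mat (submatrix A S S)"
    and x: "x \<in> carrier_vec n" "\<And>i. i < n \<Longrightarrow> i \<notin> S \<Longrightarrow> x $ i = 0"
    and Ax: "\<And>i. i \<in> S \<Longrightarrow> (A *\<^sub>v x) $ i = 0"
  shows "x = 0\<^sub>v n"
proof -
  define c where "c = card S"
  have fin: "finite S" using S finite_subset by blast
  have bij: "bij_betw (pick S) {..<c} S" unfolding c_def using fin by (rule bij_betw_pick)
  have dims: "{i. i < n \<and> i \<in> S} = S" using S by auto
  have sub: "submatrix A S S \<in> carrier_mat c c"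
    using A by (auto simp: dim_submatrix dims c_def intro!: carrier_matI)
  define x' where "x' = vec c (\<lambda>i. x $ pick S i)"
  have "submatrix A S S *\<^sub>v x' = 0\<^sub>v c"
  proof (rule eq_vecI)
    fix i assume "i < dim_vec (0\<^sub>v c :: 'a vec)"
    then have i: "i < c" by simp
    then have p: "pick S i \<in> S" using bij by (auto simp: bij_betw_def)
    have "(submatrix A S S *\<^sub>v x') $ i = (\<Sum>j<c. A $$ (pick S i, pick S j) * x $ pick S j)"
      using i A sub by (auto simp: scalar_prod_def submatrix_def dims c_def x'_def atLeast0LessThan intro!: sum.cong)
    also have "\<dots> = (\<Sum>s\<in>S. A $$ (pick S i, s) * x $ s)"
      by (rule sum.reindex_bij_betw[OF bij])
    also have "\<dots> = (\<Sum>s<n. A $$ (pick S i, s) * x $ s)"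
      using S x by (intro sum.mono_neutral_left) auto
    also have "\<dots> = (A *\<^sub>v x) $ pick S i"
      using A x p S by (auto simp: scalar_prod_def atLeast0LessThan intro!: sum.cong)
    finally show "(submatrix A S S *\<^sub>v x') $ i = 0\<^sub>v c $ i" using Ax p i by simp
  qed (use sub in auto)
  moreover obtain B where B: "B \<in> carrier_mat c c" "B * submatrix A S S = 1\<^sub>m c"
    using invertible_matE[OF sub inv] by metis
  moreover have x': "x' \<in> carrier_vec c" by (simp add: x'_def)
  ultimately have "x' = B *\<^sub>v 0\<^sub>v c"
    using sub by (metis assoc_mult_mat_vec one_mult_mat_vec)
  then have x'0: "x' = 0\<^sub>v c" using B by auto
  show ?thesis
  proof (rule eq_vecI)
    fix s assume "s < dim_vec (0\<^sub>v n :: 'a vec)"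
    then have s: "s < n" by simp
    show "x $ s = 0\<^sub>v n $ s"
    proof (cases "s \<in> S")
      case True
      then obtain i where "i < c" "s = pick S i" using bij by (auto simp: bij_betw_def)
      then show ?thesis using arg_cong[OF x'0, of "\<lambda>v. v $ i"] s by (simp add: x'_def)
    qed (use x s in auto)
  qed (use x in auto)
qed

lemma unit_vec_append: "k < n \<Longrightarrow> unit_vec (n + m) k = unit_vec n k @\<^sub>v 0\<^sub>v m"
  by (rule eq_vecI) auto

section \<open>Kron reduction as elimination of interior potentials\<close>

locale kron_reducible =
  fixes M :: "complex mat" and a N :: nat
  assumes M_carrier: "M \<in> carrier_mat a a"
    and M_sym: "transpose_mat M = M"
    and boundary: "N \<le> a"
    and interior: "invertible_mat (submatrix M {N..<a} {N..<a})"
begin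

abbreviation "A \<equiv> submatrix M {..<N} {..<N}"
abbreviation "B \<equiv> submatrix M {..<N} {N..<a}"
abbreviation "D \<equiv> submatrix M {N..<a} {N..<a}"
abbreviation "D' \<equiv> the (mat_inverse D)"
abbreviation "Y \<equiv> kron_reduction N M"

lemma card_indices: "card {i. i < a \<and> i \<in> {..<N}} = N" "card {i. i < a \<and> i \<in> {N..<a}} = a - N"
proof -
  have "{i. i < a \<and> i \<in> {..<N}} = {..<N}" "{i. i < a \<and> i \<in> {N..<a}} = {N..<a}" using boundary by auto
  then show "card {i. i < a \<and> i \<in> {..<N}} = N" "card {i. i < a \<and> i \<in> {N..<a}} = a - N" by simp_all
qed

lemma blocks_carrier:
  "A \<in> carrier_mat N N" "B \<in> carrier_mat N (a - N)" "D \<in> carrier_mat (a - N) (a - N)"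
  "D' \<in> carrier_mat (a - N) (a - N)"
proof -
  show "A \<in> carrier_mat N N" "B \<in> carrier_mat N (a - N)" and D: "D \<in> carrier_mat (a - N) (a - N)"
    using M_carrier by (auto intro!: carrier_matI simp: dim_submatrix card_indices simp del: lessThan_iff atLeastLessThan_iff)
  show "D' \<in> carrier_mat (a - N) (a - N)" by (rule the_mat_inverse(1)[OF D interior])
qed

lemma D_inverse: "D * D' = 1\<^sub>m (a - N)" "D' * D = 1\<^sub>m (a - N)"
  using the_mat_inverse(2,3)[OF blocks_carrier(3) interior] by auto

lemma kron_eq: "Y = A - B * D' * transpose_mat B"
  using M_carrier by (simp add: kron_reduction_def Let_def)

lemma kron_carrier: "Y \<in> carrier_mat N N"
  using blocks_carrier by (auto simp: kron_eq)

text \<open>Boundary nodes come first, so \<open>pick\<close> is the identity on them and a shift by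
  \<open>N\<close> on the interior; symmetry supplies the lower left block.\<close>

lemma blocks: "M = four_block_mat A B (transpose_mat B) D"
proof -
  have p: "pick {..<N} i = i" if "i < N" for i
    using pick_atLeastLessThan[of i N 0] that by (simp add: atLeast0LessThan)
  have q: "pick {N..<a} i = N + i" if "i < a - N" for i
    using pick_atLeastLessThan[OF that] .
  have "M $$ (i, j) = M $$ (j, i)" if "i < a" "j < a" for i j
    using that M_carrier M_sym by (metis index_transpose_mat(1) carrier_matD)
  then show ?thesis
    using M_carrier blocks_carrier boundary
    by (intro eq_matI) (auto simp: submatrix_def card_indices p q simp del: lessThan_iff atLeastLessThan_iff)
qed

lemma mult_append:
  assumes "v \<in> carrier_vec N" "w \<in> carrier_vec (a - N)"
  shows "M *\<^sub>v (v @\<^sub>v w) = (A *\<^sub>v v + B *\<^sub>v w) @\<^sub>v (transpose_mat B *\<^sub>v v + D *\<^sub>v w)"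
  using assms blocks_carrier by (subst blocks) (intro four_block_mat_mult_vec, auto)

lemma kron_mult_vec:
  assumes v: "v \<in> carrier_vec N"
  shows "Y *\<^sub>v v = A *\<^sub>v v - B *\<^sub>v (D' *\<^sub>v (transpose_mat B *\<^sub>v v))"
proof -
  have "B * D' * transpose_mat B *\<^sub>v v = B *\<^sub>v (D' *\<^sub>v (transpose_mat B *\<^sub>v v))"
    using v blocks_carrier by (simp add: assoc_mult_mat_vec[of _ N "a - N" _ N] assoc_mult_mat_vec[of _ N "a - N" _ "a - N"])
  then show ?thesis
    using v blocks_carrier by (simp add: kron_eq minus_mult_distrib_mat_vec[of _ N N])
qed

text \<open>The vanishing interior currents determine the interior potentials as
  \<open>- D' B^T v\<close>; substituting them into the upper block row produces the Schur
  complement.\<close>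

lemma kron_current:
  assumes x: "x \<in> carrier_vec a" and b: "b \<in> carrier_vec N" and Mx: "M *\<^sub>v x = b @\<^sub>v 0\<^sub>v (a - N)"
  shows "Y *\<^sub>v vec_first x N = b"
proof -
  define v w where "v = vec_first x N" "w = vec_last x (a - N)"
  have vw: "v \<in> carrier_vec N" "w \<in> carrier_vec (a - N)" "x = v @\<^sub>v w"
    using x boundary by (auto simp: v_w_def)
  note c = blocks_carrier vw
  have e: "A *\<^sub>v v + B *\<^sub>v w = b" "transpose_mat B *\<^sub>v v + D *\<^sub>v w = 0\<^sub>v (a - N)"
    using Mx b c append_vec_eq[of "A *\<^sub>v v + B *\<^sub>v w" N b] by (auto simp: mult_append)
  have "D' *\<^sub>v (transpose_mat B *\<^sub>v v) + w = D' *\<^sub>v (transpose_mat B *\<^sub>v v + D *\<^sub>v w)"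
    using c assoc_mult_mat_vec[of D' "a - N" "a - N" D "a - N" w] D_inverse
    by (simp add: mult_add_distrib_mat_vec[of D' "a - N" "a - N"])
  also have "\<dots> = 0\<^sub>v (a - N)" using c e by auto
  finally have "w = - (D' *\<^sub>v (transpose_mat B *\<^sub>v v))"
    using c by (auto simp: vec_eq_iff add_eq_0_iff)
  then have "Y *\<^sub>v v = A *\<^sub>v v + B *\<^sub>v w"
    using c by (auto simp: kron_mult_vec)
  then show ?thesis using e v_w_def by simp
qed

text \<open>Converse direction: the interior potentials \<open>- u\<close> are chosen to cancel all
  interior currents.\<close>

lemma kron_extension:
  assumes v: "v \<in> carrier_vec N"
  shows "\<exists>x\<in>carrier_vec a. vec_first x N = v \<and> M *\<^sub>v x = (Y *\<^sub>v v) @\<^sub>v 0\<^sub>v (a - N)"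
proof -
  define u where "u = D' *\<^sub>v (transpose_mat B *\<^sub>v v)"
  note c = blocks_carrier
  have u: "u \<in> carrier_vec (a - N)" using c v by (auto simp: u_def)
  have "D *\<^sub>v u = (D * D') *\<^sub>v (transpose_mat B *\<^sub>v v)"
    unfolding u_def using c v by (intro assoc_mult_mat_vec[symmetric]) auto
  then have Du: "D *\<^sub>v u = transpose_mat B *\<^sub>v v" using c v by (simp add: D_inverse)
  have neg: "F *\<^sub>v (- u) = - (F *\<^sub>v u)" if "F \<in> carrier_mat r (a - N)" for F :: "complex mat" and r
    using that u by (intro eq_vecI) auto
  have "v @\<^sub>v - u \<in> carrier_vec (N + (a - N))" using v u by (intro append_carrier_vec) auto
  moreover have "vec_first (v @\<^sub>v - u) N = v"
    using v by (intro eq_vecI) (auto simp: vec_first_def)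
  moreover have "M *\<^sub>v (v @\<^sub>v - u) = (Y *\<^sub>v v) @\<^sub>v 0\<^sub>v (a - N)"
    using c v u neg[OF c(2)] neg[OF c(3)] by (simp add: mult_append kron_mult_vec Du flip: u_def) (auto intro!: arg_cong2[of _ _ _ _ append_vec] eq_vecI)
  ultimately show ?thesis using boundary by (intro bexI[of _ "v @\<^sub>v - u"]) auto
qed

end

section \<open>The uniform Laplacian \<open>Gamma_mat\<close>\<close>

text \<open>Shows the spectral structure: \<open>Gamma_mat N\<close> is multiplication by
  \<open>N\<close> on vectors of zero sum and vanishes on constants.\<close>

lemma Gamma_mult_vec:
  assumes "v \<in> carrier_vec N"
  shows "Gamma_mat N *\<^sub>v v = of_nat N \<cdot>\<^sub>v v - (ones_vec N \<bullet> v) \<cdot>\<^sub>v ones_vec N"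
proof -
  have "mat N N (\<lambda>_. 1) *\<^sub>v v = (ones_vec N \<bullet> v) \<cdot>\<^sub>v ones_vec N"
    using assms by (intro eq_vecI) (auto simp: scalar_prod_def)
  moreover have "(of_nat N \<cdot>\<^sub>m 1\<^sub>m N) *\<^sub>v v = of_nat N \<cdot>\<^sub>v v"
    using assms by (intro eq_vecI) auto
  ultimately show ?thesis
    using assms by (simp add: Gamma_mat_def minus_mult_distrib_mat_vec[of _ N N])
qed

lemma Gamma_carrier: "Gamma_mat N \<in> carrier_mat N N"
  by (auto simp: Gamma_mat_def intro!: carrier_matI)

lemma index_Gamma_mat:
  "i < N \<Longrightarrow> j < N \<Longrightarrow> Gamma_mat N $$ (i, j) = (if i = j then of_nat N else 0) - 1"
  by (simp add: Gamma_mat_def)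

section \<open>Uniformity without shunts\<close>

locale unshunted_network = balanced_matrix M a + kron_reducible M a N
  for M :: "complex mat" and a N :: nat +
  assumes two_le: "2 \<le> N"
begin

lemma kron_ones: "Y *\<^sub>v ones_vec N = 0\<^sub>v N"
proof -
  have "vec_first (ones_vec a) N = ones_vec N"
    using boundary by (intro eq_vecI) (auto simp: vec_first_def)
  moreover have "(0\<^sub>v N :: complex vec) @\<^sub>v 0\<^sub>v (a - N) = 0\<^sub>v a"
    using boundary by (intro eq_vecI) auto
  ultimately show ?thesis
    using kron_current[of "ones_vec a" "0\<^sub>v N"] ones by simp
qed

lemma unit_diff_append:
  assumes "k < N" "l < N"
  shows "(unit_vec a k - unit_vec a l :: complex vec) = (unit_vec N k - unit_vec N l) @\<^sub>v 0\<^sub>v (a - N)"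
  using assms boundary by (intro eq_vecI) auto

text \<open>The potentials of currents between boundary nodes show that \<open>Y\<close> acts as
  \<open>2 / z\<close> on differences of unit vectors. Together with the vanishing row sums this
  determines \<open>Y\<close>.\<close>

lemma uniform_impedances_imp_kron:
  assumes "uniform_impedances N (effective_impedance M) z"
  shows "uniform_admittances N Y (2 / (of_nat N * z))"
proof -
  from assms have z: "z \<noteq> 0" "\<And>n m. n < N \<Longrightarrow> m < N \<Longrightarrow> n \<noteq> m \<Longrightarrow> effective_impedance M n m = z"
    by (auto simp: uniform_impedances_def)
  \<comment> \<open>Polarisation is also evaluated at coinciding nodes, about which
    \<open>uniform_impedances\<close> says nothing.\<close>
  have self: "effective_impedance M n n = 0" if "n < N" for n
  proof -
    have "M *\<^sub>v 0\<^sub>v a = unit_vec a n - unit_vec a n" using carrier by auto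
    then show ?thesis using effective_impedance_eq[of "0\<^sub>v a" n n] that boundary by simp
  qed
  have diff: "Y *\<^sub>v (unit_vec N k - unit_vec N m) = (2 / z) \<cdot>\<^sub>v (unit_vec N k - unit_vec N m)"
    if km: "k < N" "m < N" "k \<noteq> m" for k m
  proof -
    obtain x where x: "x \<in> carrier_vec a" "M *\<^sub>v x = unit_vec a k - unit_vec a m"
      using unit_diff_solvable[of k m] km boundary by auto
    define u :: "complex vec" where "u = unit_vec N k - unit_vec N m"
    have u: "u \<in> carrier_vec N" by (simp add: u_def)
    \<comment> \<open>Relative to node \<open>m\<close> the potential is \<open>z\<close> at
      \<open>k\<close>, 0 at \<open>m\<close> and \<open>z / 2\<close> at every other boundary
      node.\<close>
    have "x $ l = (x $ m + z / 2) + z / 2 * u $ l" if "l < N" for l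
      using potential_polarisation[OF x, of l] km that boundary z self
      by (cases "l = k"; cases "l = m") (auto simp: u_def field_simps)
    then have "vec_first x N = (x $ m + z / 2) \<cdot>\<^sub>v ones_vec N + (z / 2) \<cdot>\<^sub>v u"
      using u boundary by (intro eq_vecI) (auto simp: vec_first_def)
    then have "(x $ m + z / 2) \<cdot>\<^sub>v (Y *\<^sub>v ones_vec N) + (z / 2) \<cdot>\<^sub>v (Y *\<^sub>v u) = u"
      using kron_current[OF x(1) u] x(2) km kron_carrier u
      by (simp add: unit_diff_append u_def[symmetric] mult_add_distrib_mat_vec[of _ N N] mult_mat_vec[of _ N N])
    moreover have smult_zero: "c \<cdot>\<^sub>v 0\<^sub>v N = 0\<^sub>v N" for c :: complex by auto
    ultimately have Yu: "(z / 2) \<cdot>\<^sub>v (Y *\<^sub>v u) = u"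
      using u kron_carrier smult_zero by (simp add: kron_ones)
    have "Y *\<^sub>v u = (2 / z) \<cdot>\<^sub>v ((z / 2) \<cdot>\<^sub>v (Y *\<^sub>v u))"
      using z(1) by (simp add: smult_smult_assoc)
    then show ?thesis unfolding Yu by (simp add: u_def)
  qed
  have "Y $$ (i, k) = 2 / (of_nat N * z) * Gamma_mat N $$ (i, k)" if ik: "i < N" "k < N" for i k
  proof -
    have eq: "Y $$ (i, k) - Y $$ (i, m) = (2 / z) * ((if i = k then 1 else 0) - (if i = m then 1 else 0))" if "m < N" for m
    proof (cases "k = m")
      case False
      have "(Y *\<^sub>v (unit_vec N k - unit_vec N m)) $ i = Y $$ (i, k) - Y $$ (i, m)"
        using ik that kron_carrier
        by (simp add: mult_minus_distrib_mat_vec[of _ N N])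
      then show ?thesis
        using diff[OF ik(2) that False] ik that by simp
    qed simp
    have "(Y *\<^sub>v ones_vec N) $ i = (\<Sum>m<N. Y $$ (i, m))"
      using ik kron_carrier by (simp add: scalar_prod_def atLeast0LessThan)
    then have "(\<Sum>m<N. Y $$ (i, m)) = 0" using ik by (simp add: kron_ones)
    \<comment> \<open>Summing the column differences over \<open>m\<close> isolates a single entry,
      because row \<open>i\<close> sums to zero.\<close>
    then have "of_nat N * Y $$ (i, k) = (\<Sum>m<N. Y $$ (i, k) - Y $$ (i, m))"
      by (simp add: sum_subtractf)
    also have "\<dots> = (2 / z) * (\<Sum>m<N. (if i = k then 1 else 0) - (if i = m then 1 else 0))"
      unfolding sum_distrib_left by (intro sum.cong) (auto simp: eq)
    also have "(\<Sum>m<N. (if i = k then 1 else 0) - (if i = m then 1 else 0)) = Gamma_mat N $$ (i, k)"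
      using ik by (simp add: sum_subtractf index_Gamma_mat)
    finally show ?thesis using two_le z by (simp add: field_simps)
  qed
  then have "Y = (2 / (of_nat N * z)) \<cdot>\<^sub>m Gamma_mat N"
    using kron_carrier Gamma_carrier[of N] by (intro eq_matI) auto
  then show ?thesis using z two_le by (simp add: uniform_admittances_def)
qed

lemma uniform_kron_imp_impedance:
  assumes "uniform_admittances N Y s" and nm: "n < N" "m < N" "n \<noteq> m"
  shows "effective_impedance M n m = 2 / (of_nat N * s)"
proof -
  from assms have s: "s \<noteq> 0" and Y: "Y = s \<cdot>\<^sub>m Gamma_mat N"
    by (auto simp: uniform_admittances_def)
  define u :: "complex vec" where "u = unit_vec N n - unit_vec N m"
  have u: "u \<in> carrier_vec N" "ones_vec N \<bullet> u = 0"
    using nm by (auto simp: u_def scalar_prod_minus_distrib[of _ N])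
  \<comment> \<open>\<open>u\<close> has zero sum, so \<open>Y\<close> multiplies it by
    \<open>N s\<close>; this is a boundary potential with current \<open>u\<close>.\<close>
  define v where "v = (1 / (of_nat N * s)) \<cdot>\<^sub>v u"
  have v: "v \<in> carrier_vec N" using u by (simp add: v_def)
  have "Y *\<^sub>v v = s \<cdot>\<^sub>v (Gamma_mat N *\<^sub>v v)"
    using v Gamma_carrier[of N] unfolding Y by (intro eq_vecI) auto
  also have "\<dots> = u"
    using u v s two_le by (simp add: Gamma_mult_vec v_def) (auto intro!: eq_vecI)
  finally have Yv: "Y *\<^sub>v v = u" .
  obtain x where x: "x \<in> carrier_vec a" "vec_first x N = v" "M *\<^sub>v x = u @\<^sub>v 0\<^sub>v (a - N)"
    using kron_extension[OF v] by (auto simp: Yv)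
  have "x $ i = v $ i" if "i < N" for i
    using x(2) that by (auto simp: vec_first_def)
  then have "x $ n - x $ m = 2 / (of_nat N * s)"
    using nm by (simp add: v_def u_def)
  then show ?thesis
    using effective_impedance_eq[of x n m] x nm boundary by (simp add: u_def unit_diff_append)
qed

lemma uniform_iff:
  "(\<exists>z. uniform_impedances N (effective_impedance M) z) \<longleftrightarrow> (\<exists>s. uniform_admittances N Y s)"
proof
  assume "\<exists>s. uniform_admittances N Y s"
  then obtain s where s: "uniform_admittances N Y s" by blast
  then have "uniform_impedances N (effective_impedance M) (2 / (of_nat N * s))"
    using uniform_kron_imp_impedance[OF s] two_le
    by (auto simp: uniform_impedances_def uniform_admittances_def)
  then show "\<exists>z. uniform_impedances N (effective_impedance M) z" by blast
qed (use uniform_impedances_imp_kron in blast)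

lemma uniform_value:
  assumes "uniform_impedances N (effective_impedance M) z" "uniform_admittances N Y s"
  shows "z = 2 / (of_nat N * s)"
  using assms uniform_kron_imp_impedance[of s 0 1] two_le by (auto simp: uniform_impedances_def)

end

section \<open>Uniformity with shunts\<close>

text \<open>\<open>M\<close> is the matrix to be reduced, while the impedances come from the
  augmented matrix \<open>H\<close>. \<open>grounding\<close> connects the two: the current injected
  at \<open>k\<close> returns through the ground, which is held at potential 0.
  \<open>self_potential\<close> keeps the impedance to ground from vanishing.\<close>

locale shunted_network = balanced_matrix H "a + 1" + kron_reducible M a N
  for M H :: "complex mat" and a N :: nat +
  assumes two_le: "2 \<le> N"
    and regular: "invertible_mat M"
    and grounding: "\<And>x k. x \<in> carrier_vec a \<Longrightarrow> k < a \<Longrightarrow> M *\<^sub>v x = unit_vec a k \<Longrightarrow>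
      H *\<^sub>v (x @\<^sub>v 0\<^sub>v 1) = unit_vec (a + 1) k - unit_vec (a + 1) a"
    and self_potential: "\<And>x k. x \<in> carrier_vec a \<Longrightarrow> k < N \<Longrightarrow> M *\<^sub>v x = unit_vec a k \<Longrightarrow> x $ k \<noteq> 0"
begin

abbreviation "z \<equiv> effective_impedance H"

text \<open>With the ground at potential 0, the entries of \<open>x\<close> are already differences
  to the ground, so the second equation is polarisation at \<open>g = a\<close>.\<close>

lemma grounded_potential:
  assumes x: "x \<in> carrier_vec a" "M *\<^sub>v x = unit_vec a k" and kl: "k < a" "l < a"
  shows "x $ k = z k a" "x $ l = (z k a + z l a - z k l) / 2"
proof -
  have x0: "x @\<^sub>v 0\<^sub>v 1 \<in> carrier_vec (a + 1)" using x by (intro append_carrier_vec) auto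
  note Hx = grounding[OF x(1) kl(1) x(2)]
  have "(x @\<^sub>v 0\<^sub>v 1) $ a = 0" "(x @\<^sub>v 0\<^sub>v 1) $ k = x $ k" "(x @\<^sub>v 0\<^sub>v 1) $ l = x $ l"
    using x kl by auto
  then show "x $ k = z k a" "x $ l = (z k a + z l a - z k l) / 2"
    using effective_impedance_eq[OF x0 Hx] potential_polarisation[OF x0 Hx, of l] kl by auto
qed

lemma unit_append: "k < N \<Longrightarrow> (unit_vec a k :: complex vec) = unit_vec N k @\<^sub>v 0\<^sub>v (a - N)"
  using unit_vec_append[of k N "a - N"] boundary by simp

text \<open>With \<open>J\<close> the all-ones matrix, uniformity amounts to
  \<open>Y (\<alpha> I + \<beta> J) = I\<close>. The row sums of \<open>Y\<close> are found first,
  then its entries.\<close>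

lemma uniform_impedances_imp_kron:
  assumes u: "uniform_impedances_shunt N a z zs zh" and "zs / zh \<noteq> 2"
  shows "\<exists>s h. uniform_admittances_shunt N Y s h"
proof -
  \<comment> \<open>For a unit current into a boundary node, \<open>\<beta>\<close> is the potential
    of the other boundary nodes and \<open>\<alpha>\<close> the excess at the injection node. The
    ratio 2 is exactly \<open>\<beta> = 0\<close>.\<close>
  define \<alpha> \<beta> where "\<alpha> = zs / 2" "\<beta> = zh - zs / 2"
  have \<alpha>: "\<alpha> \<noteq> 0" and \<beta>: "\<beta> \<noteq> 0"
    using assms by (auto simp: uniform_impedances_shunt_def \<alpha>_\<beta>_def field_simps)
  have z: "z n m = zs" if "n < N" "m < N" "n \<noteq> m" for n m
    using u that by (auto simp: uniform_impedances_shunt_def)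
  have zg: "z n a = zh" if "n < N" for n
    using u that by (auto simp: uniform_impedances_shunt_def)
  obtain W where W: "W \<in> carrier_mat a a" "M * W = 1\<^sub>m a"
    using invertible_matE[OF M_carrier regular] by metis
  have entry: "\<alpha> * Y $$ (i, k) + \<beta> * (\<Sum>m<N. Y $$ (i, m)) = (if i = k then 1 else 0)"
    if ik: "i < N" "k < N" for i k
  proof -
    define x where "x = W *\<^sub>v unit_vec a k"
    have x: "x \<in> carrier_vec a" "M *\<^sub>v x = unit_vec a k"
      using W M_carrier assoc_mult_mat_vec[of M a a W a "unit_vec a k"] by (auto simp: x_def)
    have "x $ l = \<alpha> * (if l = k then 1 else 0) + \<beta>" if "l < N" for l
    proof (cases "l = k")
      case True
      \<comment> \<open>The index 0 merely instantiates \<open>l\<close>, which does not occur in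
        the first equation.\<close>
      then show ?thesis using grounded_potential(1)[OF x, of 0] ik boundary zg by (simp add: \<alpha>_\<beta>_def)
    next
      case False
      then show ?thesis
        using grounded_potential(2)[OF x, of l] ik that boundary zg z[of k l] by (simp add: \<alpha>_\<beta>_def field_simps)
    qed
    then have "vec_first x N = \<alpha> \<cdot>\<^sub>v unit_vec N k + \<beta> \<cdot>\<^sub>v ones_vec N"
      using boundary x ik by (intro eq_vecI) (auto simp: vec_first_def)
    then have "\<alpha> \<cdot>\<^sub>v (Y *\<^sub>v unit_vec N k) + \<beta> \<cdot>\<^sub>v (Y *\<^sub>v ones_vec N) = unit_vec N k"
      using kron_current[OF x(1), of "unit_vec N k"] x(2) ik kron_carrier
      by (simp add: unit_append mult_add_distrib_mat_vec[of _ N N] mult_mat_vec[of _ N N])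
    from arg_cong[OF this, of "\<lambda>v. v $ i"]
    have "\<alpha> * Y $$ (i, k) + \<beta> * (Y *\<^sub>v ones_vec N) $ i = (if i = k then 1 else 0)"
      using ik kron_carrier by simp
    then show ?thesis
      using ik kron_carrier by (simp add: scalar_prod_def atLeast0LessThan)
  qed
  \<comment> \<open>The eigenvalue of \<open>\<alpha> I + \<beta> J\<close> on constants; summing
    \<open>entry\<close> over \<open>k\<close> shows that its inverse is every row sum of
    \<open>Y\<close>.\<close>
  define t where "t = \<alpha> + of_nat N * \<beta>"
  have sum: "t * (\<Sum>m<N. Y $$ (i, m)) = 1" if "i < N" for i
  proof -
    have "(\<Sum>k<N. \<alpha> * Y $$ (i, k) + \<beta> * (\<Sum>m<N. Y $$ (i, m))) = (\<Sum>k<N. if i = k then 1 else 0)"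
      using that entry by (intro sum.cong) auto
    then show ?thesis
      using that by (simp add: sum.distrib t_def algebra_simps flip: sum_distrib_left)
  qed
  have t: "t \<noteq> 0" using sum[of 0] two_le by auto
  \<comment> \<open>\<open>h\<close> is the common row sum, as \<open>Gamma_mat N\<close> has zero
    row sums, and \<open>- s\<close> is the off-diagonal entry of \<open>Y\<close>.\<close>
  define s h where "s = \<beta> / (t * \<alpha>)" "h = 1 / t"
  have "Y $$ (i, k) = h * (if i = k then 1 else 0) + s * Gamma_mat N $$ (i, k)" if ik: "i < N" "k < N" for i k
  proof -
    have "(\<Sum>m<N. Y $$ (i, m)) = 1 / t" using sum ik t by (simp add: field_simps)
    then have "Y $$ (i, k) = ((if i = k then 1 else 0) - \<beta> / t) / \<alpha>"
      using entry[OF ik] \<alpha> by (simp add: field_simps split: if_splits)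
    then show ?thesis
      using \<alpha> t ik by (auto simp: index_Gamma_mat s_h_def field_simps) (simp add: t_def field_simps)
  qed
  then have "Y = h \<cdot>\<^sub>m 1\<^sub>m N + s \<cdot>\<^sub>m Gamma_mat N"
    using kron_carrier Gamma_carrier[of N] by (intro eq_matI) auto
  \<comment> \<open>This is the eigenvalue of \<open>Y\<close> on vectors of zero sum.\<close>
  moreover have "h + of_nat N * s = 1 / \<alpha>"
    using \<alpha> t by (simp add: s_h_def field_simps) (simp add: t_def field_simps)
  then have "h \<noteq> - of_nat N * s" using \<alpha> by auto
  ultimately have "uniform_admittances_shunt N Y s h"
    using \<alpha> \<beta> t by (simp add: uniform_admittances_shunt_def s_h_def)
  then show ?thesis by blast
qed

lemma uniform_kron_imp_potential:
  assumes "uniform_admittances_shunt N Y s h" and k: "k < N"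
  obtains x where "x \<in> carrier_vec a" "M *\<^sub>v x = unit_vec a k"
    "\<And>i. i < N \<Longrightarrow> x $ i = ((if i = k then 1 else 0) + s / h) / (of_nat N * s + h)"
proof -
  define t where "t = of_nat N * s + h"
  from assms have s: "s \<noteq> 0" "h \<noteq> 0" and t: "t \<noteq> 0" and Y: "Y = h \<cdot>\<^sub>m 1\<^sub>m N + s \<cdot>\<^sub>m Gamma_mat N"
    by (auto simp: uniform_admittances_shunt_def t_def add_eq_0_iff)
  \<comment> \<open>\<open>Y\<close> maps \<open>unit_vec N k\<close> to \<open>t e_k - s 1\<close>
    and the all-ones vector \<open>1\<close> to \<open>h 1\<close>, so this combination is the
    preimage of \<open>unit_vec N k\<close>.\<close>
  define v where "v = (1 / t) \<cdot>\<^sub>v unit_vec N k + (s / (h * t)) \<cdot>\<^sub>v ones_vec N"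
  have v: "v \<in> carrier_vec N" by (simp add: v_def)
  have "(ones_vec N :: complex vec) \<bullet> ones_vec N = of_nat N" by (simp add: scalar_prod_def)
  then have sum_v: "ones_vec N \<bullet> v = 1 / t + of_nat N * (s / (h * t))"
    using k by (simp add: v_def scalar_prod_add_distrib[of _ N])
  have "Y *\<^sub>v v = h \<cdot>\<^sub>v v + s \<cdot>\<^sub>v (Gamma_mat N *\<^sub>v v)"
    using v Gamma_carrier[of N] unfolding Y
    by (intro eq_vecI) (auto simp: add_scalar_prod_distrib[of _ N])
  also have "\<dots> = unit_vec N k"
  proof (rule eq_vecI)
    fix i assume "i < dim_vec (unit_vec N k :: complex vec)"
    then have i: "i < N" by simp
    have "(h \<cdot>\<^sub>v v + s \<cdot>\<^sub>v (Gamma_mat N *\<^sub>v v)) $ i = h * v $ i + s * (of_nat N * v $ i - (1 / t + of_nat N * (s / (h * t))))"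
      using v i by (simp add: Gamma_mult_vec sum_v)
    also have "\<dots> = t * v $ i - (s * h + of_nat N * s * s) / (h * t)"
      using s t by (simp add: field_simps) (simp add: t_def field_simps)
    also have "s * h + of_nat N * s * s = s * t" by (simp add: t_def algebra_simps)
    also have "t * v $ i - s * t / (h * t) = unit_vec N k $ i"
      using i k s t by (simp add: v_def field_simps)
    finally show "(h \<cdot>\<^sub>v v + s \<cdot>\<^sub>v (Gamma_mat N *\<^sub>v v)) $ i = unit_vec N k $ i" .
  qed (use v Gamma_carrier[of N] in auto)
  finally have Yv: "Y *\<^sub>v v = unit_vec N k" .
  obtain x where x: "x \<in> carrier_vec a" "vec_first x N = v" "M *\<^sub>v x = unit_vec a k"
    using kron_extension[OF v] k by (auto simp: Yv unit_append)
  moreover have "x $ i = ((if i = k then 1 else 0) + s / h) / (of_nat N * s + h)" if "i < N" for i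
  proof -
    have "x $ i = v $ i" using x(2) that by (auto simp: vec_first_def)
    then show ?thesis using that k s t by (simp add: v_def flip: t_def) (simp add: field_simps)
  qed
  ultimately show ?thesis using that by blast
qed

text \<open>The impedance to ground is the potential at the injection node; the one between boundary
  nodes follows by solving the polarisation identity for it. Nonvanishing rests on
  \<open>self_potential\<close>, since the uniform form of \<open>Y\<close> alone would allow
  \<open>h + s = 0\<close>.\<close>

lemma uniform_kron_imp_impedances:
  assumes u: "uniform_admittances_shunt N Y s h" and k: "k < N"
  shows "z k a = (h + s) / (h * (of_nat N * s + h))" "z k a \<noteq> 0"
    "\<And>l. l < N \<Longrightarrow> k \<noteq> l \<Longrightarrow> z k l = 2 / (of_nat N * s + h)"
proof -
  from u have h: "h \<noteq> 0" "of_nat N * s + h \<noteq> 0"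
    by (auto simp: uniform_admittances_shunt_def add_eq_0_iff)
  have zg: "z l a = (1 + s / h) / (of_nat N * s + h)" "z l a \<noteq> 0" if l: "l < N" for l
  proof -
    obtain x where x: "x \<in> carrier_vec a" "M *\<^sub>v x = unit_vec a l"
      "\<And>i. i < N \<Longrightarrow> x $ i = ((if i = l then 1 else 0) + s / h) / (of_nat N * s + h)"
      using uniform_kron_imp_potential[OF u l] by blast
    then have "x $ l = z l a" using grounded_potential(1)[OF x(1,2), of l] l boundary by simp
    then show "z l a = (1 + s / h) / (of_nat N * s + h)" "z l a \<noteq> 0"
      using x(3)[OF l] self_potential[OF x(1) l x(2)] by simp_all
  qed
  show "z k a = (h + s) / (h * (of_nat N * s + h))"
    using zg(1)[OF k] h by (simp add: field_simps)
  show "z k a \<noteq> 0" using zg(2)[OF k] .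
  show "z k l = 2 / (of_nat N * s + h)" if l: "l < N" "k \<noteq> l" for l
  proof -
    obtain x where x: "x \<in> carrier_vec a" "M *\<^sub>v x = unit_vec a k"
      "\<And>i. i < N \<Longrightarrow> x $ i = ((if i = k then 1 else 0) + s / h) / (of_nat N * s + h)"
      using uniform_kron_imp_potential[OF u k] by blast
    have "x $ l = (z k a + z l a - z k l) / 2"
      using grounded_potential(2)[OF x(1,2), of l] k l boundary by simp
    then have "z k l = z k a + z l a - 2 * x $ l" by (simp add: field_simps)
    also have "\<dots> = (1 + s / h) / (of_nat N * s + h) + (1 + s / h) / (of_nat N * s + h)
        - 2 * ((s / h) / (of_nat N * s + h))"
      using x(3)[OF l(1)] l zg(1)[OF k] zg(1)[OF l(1)] by simp
    also have "\<dots> = 2 / (of_nat N * s + h)"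
      by (simp add: add_divide_distrib)
    finally show ?thesis .
  qed
qed

lemma uniform_iff:
  "(\<exists>zs zh. uniform_impedances_shunt N a z zs zh \<and> zs / zh \<noteq> 2)
    \<longleftrightarrow> (\<exists>s h. uniform_admittances_shunt N Y s h)"
proof
  assume "\<exists>s h. uniform_admittances_shunt N Y s h"
  then obtain s h where u: "uniform_admittances_shunt N Y s h" by blast
  define t where "t = of_nat N * s + h"
  from u have s: "s \<noteq> 0" "h \<noteq> 0" "t \<noteq> 0"
    by (auto simp: uniform_admittances_shunt_def t_def add_eq_0_iff)
  define zs zh where "zs = 2 / t" "zh = (h + s) / (h * t)"
  note z = uniform_kron_imp_impedances[OF u]
  have zh: "zh \<noteq> 0" using z(1,2)[of 0] two_le by (simp add: zs_zh_def t_def)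
  then have hs: "h + s \<noteq> 0" by (auto simp: zs_zh_def)
  \<comment> \<open>In this form the ratio equals 2 only for \<open>s = 0\<close> and
    \<open>2 N / (N - 1)\<close> only for \<open>t = 0\<close>.\<close>
  have ratio: "zs / zh = 2 * h / (h + s)"
    using s hs by (simp add: zs_zh_def field_simps)
  have N: "(of_nat N :: complex) - 1 \<noteq> 0" using two_le by simp
  have "zs / zh \<noteq> 2" using s hs by (simp add: ratio field_simps)
  moreover have "zs / zh \<noteq> 2 * of_nat N / (of_nat N - 1)"
  proof
    assume "zs / zh = 2 * of_nat N / (of_nat N - 1)"
    then have "h * (of_nat N - 1) = of_nat N * (h + s)"
      using hs N by (simp add: ratio frac_eq_eq)
    then have "t = 0" by (simp add: t_def algebra_simps)
    then show False using s by simp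
  qed
  ultimately have "uniform_impedances_shunt N a z zs zh \<and> zs / zh \<noteq> 2"
    using s zh z by (auto simp: uniform_impedances_shunt_def zs_zh_def t_def)
  then show "\<exists>zs zh. uniform_impedances_shunt N a z zs zh \<and> zs / zh \<noteq> 2" by blast
qed (use uniform_impedances_imp_kron in blast)

lemma uniform_values:
  assumes "uniform_impedances_shunt N a z zs zh" "uniform_admittances_shunt N Y s h"
  shows "zs = 2 / (of_nat N * s + h)" "zh = (h + s) / (h * (of_nat N * s + h))"
proof -
  have "z 0 1 = zs" "z 0 a = zh"
    using assms(1) two_le by (auto simp: uniform_impedances_shunt_def)
  then show "zs = 2 / (of_nat N * s + h)" "zh = (h + s) / (h * (of_nat N * s + h))"
    using uniform_kron_imp_impedances(1)[OF assms(2), of 0] uniform_kron_imp_impedances(3)[OF assms(2), of 0 1] two_le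
    by simp_all
qed

end

section \<open>Admittance matrices of a concrete network\<close>

context electrical_network
begin

abbreviation "M \<equiv> admittance_matrix a E y y\<^sub>s"
abbreviation "H \<equiv> augmented_admittance_matrix a E y y\<^sub>s"

lemma admittance_carrier: "M \<in> carrier_mat a a"
  by (simp add: admittance_matrix_def)

lemma admittance_sym: "transpose_mat M = M"
proof -
  have "(m, n) \<in> E \<longleftrightarrow> (n, m) \<in> E" for m n using branches(2) by (auto dest: symD)
  then show ?thesis
    by (auto simp: admittance_matrix_def intro!: eq_matI branch_sym)
qed

text \<open>In each row the branch admittances on the diagonal cancel against the off-diagonal
  entries, leaving the shunt.\<close>

lemma admittance_ones: "M *\<^sub>v ones_vec a = vec a y\<^sub>s"
proof (rule eq_vecI)
  fix m assume "m < dim_vec (vec a y\<^sub>s)"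
  then have m: "m < a" by simp
  \<comment> \<open>Irreflexivity of \<open>E\<close> keeps self-loops out of the diagonal sum, so
    it ranges over off-diagonal positions only.\<close>
  have nbrs: "{k. (m, k) \<in> E} \<subseteq> {..<a} - {m}"
    using branches(1,3) by (auto simp: irrefl_def)
  have "(M *\<^sub>v ones_vec a) $ m = (\<Sum>n<a. M $$ (m, n))"
    using m by (simp add: admittance_matrix_def scalar_prod_def atLeast0LessThan)
  also have "\<dots> = M $$ (m, m) + (\<Sum>n\<in>{..<a} - {m}. M $$ (m, n))"
    using m by (simp add: sum.remove)
  also have "(\<Sum>n\<in>{..<a} - {m}. M $$ (m, n)) = (\<Sum>n\<in>{..<a} - {m}. if (m, n) \<in> E then - y m n else 0)"
    using m by (intro sum.cong) (auto simp: admittance_matrix_def)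
  also have "\<dots> = (\<Sum>k | (m, k) \<in> E. - y m k)"
    using nbrs by (intro sum.mono_neutral_cong_right) auto
  finally show "(M *\<^sub>v ones_vec a) $ m = vec a y\<^sub>s $ m"
    using m by (simp add: admittance_matrix_def sum_negf)
qed (simp add: admittance_matrix_def)

lemma augmented_carrier: "H \<in> carrier_mat (a + 1) (a + 1)"
  using admittance_carrier by (auto simp: augmented_admittance_matrix_def)

lemma augmented_sym: "transpose_mat H = H"
  unfolding augmented_admittance_matrix_def
  by (subst transpose_four_block_mat[of _ a a _ 1 _ 1])
    (auto simp: admittance_carrier admittance_sym intro!: cong_four_block_mat)

text \<open>\<open>c\<close> is the potential of the ground, and the last entry is the current
  injected there.\<close>

lemma augmented_mult_append:
  assumes "x \<in> carrier_vec a"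
  shows "H *\<^sub>v (x @\<^sub>v vec 1 (\<lambda>_. c)) =
    (M *\<^sub>v x - c \<cdot>\<^sub>v vec a y\<^sub>s) @\<^sub>v vec 1 (\<lambda>_. c * (\<Sum>m<a. y\<^sub>s m) - vec a y\<^sub>s \<bullet> x)"
proof -
  have "M *\<^sub>v x + mat a 1 (\<lambda>(m, _). - y\<^sub>s m) *\<^sub>v vec 1 (\<lambda>_. c) = M *\<^sub>v x - c \<cdot>\<^sub>v vec a y\<^sub>s"
    using admittance_carrier by (intro eq_vecI) (auto simp: scalar_prod_def)
  moreover have "mat 1 a (\<lambda>(_, n). - y\<^sub>s n) *\<^sub>v x + mat 1 1 (\<lambda>_. \<Sum>m<a. y\<^sub>s m) *\<^sub>v vec 1 (\<lambda>_. c)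
      = vec 1 (\<lambda>_. c * (\<Sum>m<a. y\<^sub>s m) - vec a y\<^sub>s \<bullet> x)"
    using assms by (intro eq_vecI) (auto simp: scalar_prod_def sum_negf)
  ultimately show ?thesis
    using assms admittance_carrier unfolding augmented_admittance_matrix_def
    by (subst four_block_mat_mult_vec[of _ a a _ 1 _ 1]) auto
qed

lemma ones_append: "ones_vec (a + 1) = ones_vec a @\<^sub>v vec 1 (\<lambda>_. 1)"
  by (rule eq_vecI) auto

lemma zero_append: "(0\<^sub>v (a + 1) :: complex vec) = 0\<^sub>v a @\<^sub>v 0\<^sub>v 1"
  by (rule eq_vecI) auto

lemma augmented_ones: "H *\<^sub>v ones_vec (a + 1) = 0\<^sub>v (a + 1)"
  unfolding ones_append zero_append
  by (subst augmented_mult_append) (auto simp: admittance_ones scalar_prod_def atLeast0LessThan intro!: arg_cong2[of _ _ _ _ append_vec] eq_vecI)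

text \<open>Conservation of current: the shunts carry off all that is injected, by symmetry of
  \<open>M\<close> and \<open>admittance_ones\<close>.\<close>

lemma shunt_scalar_prod:
  assumes "x \<in> carrier_vec a"
  shows "vec a y\<^sub>s \<bullet> x = ones_vec a \<bullet> (M *\<^sub>v x)"
  using transpose_vec_mult_scalar[OF admittance_carrier assms, of "ones_vec a"]
  by (simp add: admittance_sym admittance_ones)

lemma augmented_grounding:
  assumes x: "x \<in> carrier_vec a" and k: "k < a" and Mx: "M *\<^sub>v x = unit_vec a k"
  shows "H *\<^sub>v (x @\<^sub>v 0\<^sub>v 1) = unit_vec (a + 1) k - unit_vec (a + 1) a"
proof -
  have "vec a y\<^sub>s \<bullet> x = 1" using k by (simp add: shunt_scalar_prod[OF x] Mx)
  then have "H *\<^sub>v (x @\<^sub>v vec 1 (\<lambda>_. 0)) = unit_vec a k @\<^sub>v vec 1 (\<lambda>_. - 1)"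
    using x by (subst augmented_mult_append) (auto simp: Mx intro!: arg_cong2[of _ _ _ _ append_vec])
  also have "\<dots> = unit_vec (a + 1) k - unit_vec (a + 1) a"
    using k by (intro eq_vecI) auto
  also have "vec 1 (\<lambda>_. 0) = (0\<^sub>v 1 :: complex vec)" by auto
  finally show ?thesis .
qed

text \<open>Shifting a kernel vector to vanish at node 0 keeps it in the kernel, and the submatrix
  omitting node 0 then forces it to be zero.\<close>

lemma unshunted_balanced:
  assumes "\<And>m. m < a \<Longrightarrow> y\<^sub>s m = 0" and a: "2 \<le> a"
    and minors: "proper_principal_submatrices_nonsingular M"
  shows "balanced_matrix M a"
proof
  show ones: "M *\<^sub>v ones_vec a = 0\<^sub>v a"
    using assms by (auto simp: admittance_ones)
  fix v :: "complex vec" assume v: "v \<in> carrier_vec a" "M *\<^sub>v v = 0\<^sub>v a"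
  define c where "c = v $ 0"
  define w where "w = v - c \<cdot>\<^sub>v ones_vec a"
  have w: "w \<in> carrier_vec a" using v by (simp add: w_def)
  have Mw: "M *\<^sub>v w = 0\<^sub>v a"
    using v admittance_carrier ones
    by (simp add: w_def mult_minus_distrib_mat_vec[of _ a a] mult_mat_vec[of _ a a]) auto
  have "w = 0\<^sub>v a"
  proof (rule principal_submatrix_kernel[OF admittance_carrier])
    have "1 \<in> {..<a} - {0}" "0 \<in> {..<a}" using a by auto
    then have "{..<a} - {0} \<noteq> {}" "{..<a} - {0} \<subset> {..<dim_row M}"
      unfolding carrier_matD(1)[OF admittance_carrier] by blast+
    then show "invertible_mat (submatrix M ({..<a} - {0}) ({..<a} - {0}))"
      using minors by (auto simp: proper_principal_submatrices_nonsingular_def)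
    show "w $ i = 0" if "i < a" "i \<notin> {..<a} - {0}" for i
      using that v by (simp add: w_def c_def)
  qed (use w Mw in auto)
  then show "\<exists>c. v = c \<cdot>\<^sub>v ones_vec a"
    using v by (intro exI[of _ c]) (auto simp: w_def vec_eq_iff)
qed (use a admittance_carrier admittance_sym in auto)

text \<open>As \<open>y\<^sub>s\<close> is \<open>M\<close> applied to the all-ones vector,
  subtracting the ground potential from a kernel vector leaves a kernel vector of the regular matrix
  \<open>M\<close>.\<close>

lemma augmented_balanced:
  assumes "invertible_mat M"
  shows "balanced_matrix H (a + 1)"
proof
  fix v assume v: "v \<in> carrier_vec (a + 1)" "H *\<^sub>v v = 0\<^sub>v (a + 1)"
  define x c where "x = vec_first v a" and "c = v $ a"
  have x: "x \<in> carrier_vec a" by (simp add: x_def)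
  have vxc: "v = x @\<^sub>v vec 1 (\<lambda>_. c)"
    using v by (intro eq_vecI) (auto simp: x_def c_def vec_first_def less_Suc_eq)
  have "M *\<^sub>v x - c \<cdot>\<^sub>v vec a y\<^sub>s = 0\<^sub>v a"
    using v(2) x admittance_carrier append_vec_eq[of "M *\<^sub>v x - c \<cdot>\<^sub>v vec a y\<^sub>s" a "0\<^sub>v a"]
    unfolding vxc augmented_mult_append[OF x] zero_append by auto
  then have "M *\<^sub>v (x - c \<cdot>\<^sub>v ones_vec a) = 0\<^sub>v a"
    using x admittance_carrier
    by (simp add: mult_minus_distrib_mat_vec[of _ a a] mult_mat_vec[of _ a a] admittance_ones)
  moreover obtain W where W: "W \<in> carrier_mat a a" "W * M = 1\<^sub>m a"
    using invertible_matE[OF admittance_carrier assms] by metis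
  ultimately have "x - c \<cdot>\<^sub>v ones_vec a = W *\<^sub>v 0\<^sub>v a"
    using x admittance_carrier assoc_mult_mat_vec[of W a a M a "x - c \<cdot>\<^sub>v ones_vec a"] by auto
  then have "x - c \<cdot>\<^sub>v ones_vec a = 0\<^sub>v a" using W by auto
  then have "x = c \<cdot>\<^sub>v ones_vec a" using x by (auto simp: vec_eq_iff)
  then show "\<exists>c. v = c \<cdot>\<^sub>v ones_vec (a + 1)"
    by (intro exI[of _ c]) (auto simp: vxc ones_append)
qed (use augmented_carrier augmented_sym augmented_ones in auto)

lemma admittance_kron_reducible:
  assumes "0 < N" and minors: "proper_principal_submatrices_nonsingular M"
  shows "kron_reducible M a N"
proof
  show "invertible_mat (submatrix M {N..<a} {N..<a})"
  proof (cases "N = a")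
    \<comment> \<open>Without interior nodes the block is the empty matrix;
      \<open>proper_principal_submatrices_nonsingular\<close> only speaks of nonempty index
      sets.\<close>
    case True
    have "submatrix M {} {} = 1\<^sub>m 0" by (intro eq_matI) (auto simp: submatrix_def)
    then show ?thesis using True by (auto simp: invertible_mat_def inverts_mat_def intro!: exI[of _ "1\<^sub>m 0"])
  next
    case False
    then have "N \<in> {N..<a}" "0 \<in> {..<a} - {N..<a}" "{N..<a} \<subseteq> {..<a}"
      using assms(1) boundary_le by auto
    then have "{N..<a} \<noteq> {}" "{N..<a} \<subset> {..<dim_row M}"
      unfolding carrier_matD(1)[OF admittance_carrier] by blast+
    then show ?thesis using minors by (auto simp: proper_principal_submatrices_nonsingular_def)
  qed
qed (use admittance_carrier admittance_sym boundary_le in auto)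

text \<open>For \<open>self_potential\<close>: if \<open>x $ k = 0\<close>, then \<open>x\<close> is
  supported off \<open>k\<close>, where its current vanishes too. The submatrix omitting
  \<open>k\<close> gives \<open>x = 0\<close>, contradicting the unit current at
  \<open>k\<close>.\<close>

lemma admittance_shunted:
  assumes "2 \<le> N" and minors: "proper_principal_submatrices_nonsingular M" and "invertible_mat M"
  shows "shunted_network M H a N"
proof -
  interpret balanced_matrix H "a + 1" using assms by (intro augmented_balanced)
  interpret kron_reducible M a N using assms by (intro admittance_kron_reducible) auto
  show ?thesis
  proof
    fix x :: "complex vec" and k
    assume x: "x \<in> carrier_vec a" and k: "k < N" and Mx: "M *\<^sub>v x = unit_vec a k"
    show "x $ k \<noteq> 0"
    proof
      assume xk: "x $ k = 0"
      define S where "S = {..<a} - {k}"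
      \<comment> \<open>Some node other than \<open>k\<close>, so that \<open>S\<close> is
        nonempty.\<close>
      have "(if k = 0 then 1 else 0) \<in> S"
        using k assms(1) boundary_le by (auto simp: S_def)
      moreover have "k \<in> {..<a}" using k boundary_le by simp
      ultimately have "S \<noteq> {}" "S \<subset> {..<dim_row M}"
        unfolding S_def carrier_matD(1)[OF admittance_carrier] by blast+
      then have "invertible_mat (submatrix M S S)"
        using minors by (auto simp: proper_principal_submatrices_nonsingular_def)
      then have "x = 0\<^sub>v a"
        using x k boundary_le xk
        by (intro principal_submatrix_kernel[OF admittance_carrier, of S])
          (auto simp: S_def Mx)
      then have "M *\<^sub>v x = 0\<^sub>v a" using admittance_carrier by auto
      then show False using k boundary_le arg_cong[OF Mx, of "\<lambda>v. v $ k"] by auto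
    qed
  qed (use assms augmented_grounding in auto)
qed

lemma admittance_unshunted:
  assumes "2 \<le> N" and "proper_principal_submatrices_nonsingular M" and "\<And>m. m < a \<Longrightarrow> y\<^sub>s m = 0"
  shows "unshunted_network M a N"
proof -
  interpret balanced_matrix M a using assms boundary_le by (intro unshunted_balanced) auto
  interpret kron_reducible M a N using assms by (intro admittance_kron_reducible) auto
  show ?thesis by unfold_locales (rule assms)
qed

end

text \<open>The ratio 2 belongs to reduced matrices that are multiples of the identity: their
  impedances are uniform, but \<open>y_series\<close> would have to be 0.\<close>

theorem theorem4:
  fixes a N :: nat
    and E :: "(nat \<times> nat) set"
    and y :: "nat \<Rightarrow> nat \<Rightarrow> complex"
    and y\<^sub>s :: "nat \<Rightarrow> complex"
    and Y\<^sub>A Y\<^sub>A_hat Y :: "complex mat"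
  defines "Y\<^sub>A \<equiv> admittance_matrix a E y y\<^sub>s"
    and "Y\<^sub>A_hat \<equiv> augmented_admittance_matrix a E y y\<^sub>s"
    and "Y \<equiv> kron_reduction N Y\<^sub>A"
  assumes "N \<ge> 2"
    and "electrical_network a N E y y\<^sub>s"
    and "proper_principal_submatrices_nonsingular Y\<^sub>A"
  shows
    "((\<forall>m<a. y\<^sub>s m = 0) \<longrightarrow>
        (let z = effective_impedance Y\<^sub>A in
          ((\<exists>z_eff. uniform_impedances N z z_eff) \<longleftrightarrow> (\<exists>y_series. uniform_admittances N Y y_series)) \<and>
          (\<forall>z_eff y_series.
             uniform_impedances N z z_eff \<and> uniform_admittances N Y y_series \<longrightarrow>
             z_eff = 2 / (of_nat N * y_series)))) \<and>
     (invertible_mat Y\<^sub>A \<longrightarrow>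
        (let z = effective_impedance Y\<^sub>A_hat in
          ((\<exists>z_series z_shunt. uniform_impedances_shunt N a z z_series z_shunt \<and> z_series / z_shunt \<noteq> 2) \<longleftrightarrow>
           (\<exists>y_series y_shunt. uniform_admittances_shunt N Y y_series y_shunt)) \<and>
          (\<forall>z_series z_shunt y_series y_shunt.
             uniform_impedances_shunt N a z z_series z_shunt \<and>
             uniform_admittances_shunt N Y y_series y_shunt \<longrightarrow>
             z_series = 2 / (of_nat N * y_series + y_shunt) \<and>
             z_shunt = (y_shunt + y_series) / (y_shunt * (of_nat N * y_series + y_shunt)))))"
proof -
  interpret electrical_network a N E y y\<^sub>s by fact
  have minors: "proper_principal_submatrices_nonsingular M"
    using assms by simp
  show ?thesis
    unfolding Let_def Y_def Y\<^sub>A_def Y\<^sub>A_hat_def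
  proof (intro conjI impI)
    assume "\<forall>m<a. y\<^sub>s m = 0"
    then interpret unshunted_network M a N
      using assms(4) minors by (intro admittance_unshunted) auto
    show "(\<exists>z_eff. uniform_impedances N (effective_impedance M) z_eff)
        \<longleftrightarrow> (\<exists>y_series. uniform_admittances N (kron_reduction N M) y_series)"
      by (rule uniform_iff)
    show "\<forall>z_eff y_series. uniform_impedances N (effective_impedance M) z_eff \<and>
        uniform_admittances N (kron_reduction N M) y_series \<longrightarrow> z_eff = 2 / (of_nat N * y_series)"
      using uniform_value by blast
  next
    assume "invertible_mat M"
    then interpret shunted_network M H a N
      using assms(4) minors by (intro admittance_shunted) auto
    show "(\<exists>z_series z_shunt. uniform_impedances_shunt N a (effective_impedance H) z_series z_shunt
          \<and> z_series / z_shunt \<noteq> 2)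
        \<longleftrightarrow> (\<exists>y_series y_shunt. uniform_admittances_shunt N (kron_reduction N M) y_series y_shunt)"
      by (rule uniform_iff)
    show "\<forall>z_series z_shunt y_series y_shunt.
        uniform_impedances_shunt N a (effective_impedance H) z_series z_shunt \<and>
        uniform_admittances_shunt N (kron_reduction N M) y_series y_shunt \<longrightarrow>
        z_series = 2 / (of_nat N * y_series + y_shunt) \<and>
        z_shunt = (y_shunt + y_series) / (y_shunt * (of_nat N * y_series + y_shunt))"
      using uniform_values by blast
  qed
qed

end
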